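(* Suppose $f\in H^2(\mathbb{D}^2)$ with $f(0,0)\neq0$. For any factorization of the form $$f(z,w)=q(z,w)\tilde f(z,w),$$ with $q$ a two-variable polynomial whose reflection $\overleftarrow{q}$ satisfies $\overleftarrow{q}(0,0)\neq0$, and any integer $n\ge0$, there exists a constant $c$ such that $$p_n^*[f]=c\cdot p_n^*[\overleftarrow{q}\tilde f],$$ where $p_n^*[g]$ denotes the $n$-th optimal polynomial approximant to $1/g$ in $H^2(\mathbb{D}^2)$.
   Context: $\mathbb{D}$ is the open unit disk in $\mathbb{C}$ and $H^2(\mathbb{D}^2)$ is the Hardy space on the bidisk: holomorphic functions on $\mathbb{D}^2$ with square-summable Taylor coefficients, with inner product $\langle f,g\rangle=\sum_{i,j\ge0}a_{i,j}\overline{b_{i,j}}$ for $f=\sum a_{i,j}z^iw^j$, $g=\sum b_{i,j}z^iw^j$ (equivalently, the $L^2(\mathbb{T}^2)$ inner product of boundary values with respect to normalized Lebesgue measure on the torus $\mathbb{T}^2$). The monomials in $z,w$ are enumerated in degree lexicographic order (increasing total degree; within total degree $d$ the order is $z^d, z^{d-1}w,\dots,w^d$): $\chi_0=1,\ \chi_1=z,\ \chi_2=w,\ \chi_3=z^2,\ \chi_4=zw,\ \chi_5=w^2,\dots$. Put $\mathcal{P}_n=\operatorname{span}\{\chi_0,\dots,\chi_n\}$. For $g\in H^2(\mathbb{D}^2)$ not identically zero and $n\ge0$, the $n$-th optimal polynomial approximant (OPA) to $1/g$, denoted $p_n^*[g]$, is the unique $p\in\mathcal{P}_n$ minimizing $\|pg-1\|$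 over $\mathcal{P}_n$; equivalently, $p_n^*[g]g$ is the orthogonal projection of $1$ onto $\mathcal{P}_ng=\{pg:p\in\mathcal{P}_n\}$. A two-variable polynomial $q$ has bi-degree $(a,b)$ if it has degree $a$ in $z$ and degree $b$ in $w$. Its reflection is the polynomial $\overleftarrow{q}(z,w)=z^aw^b\,\overline{q\left(1/\overline{z},1/\overline{w}\right)}$. *)

theory Defs
  imports
    "HOL-Complex_Analysis.Complex_Analysis"
    "HOL-Computational_Algebra.Polynomial"
    "HOL-Library.Nat_Bijection"
begin

definition bidisk :: "(complex \<times> complex) set" where
  "bidisk = ball 0 1 \<times> ball 0 1"

text \<open>Functions on the bidisk are total functions; their values outside the bidisk never matter.\<close>

definition holomorphic_bidisk :: "(complex \<times> complex \<Rightarrow> complex) \<Rightarrow> bool" where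
  "holomorphic_bidisk f \<longleftrightarrow>
     continuous_on bidisk f \<and>
     (\<forall>w\<in>ball 0 1. (\<lambda>z. f (z, w)) holomorphic_on ball 0 1) \<and>
     (\<forall>z\<in>ball 0 1. (\<lambda>w. f (z, w)) holomorphic_on ball 0 1)"

text \<open>The coefficient of $z^i w^j$ in the Taylor expansion at the origin.\<close>

definition taylor_coeff :: "(complex \<times> complex \<Rightarrow> complex) \<Rightarrow> nat \<times> nat \<Rightarrow> complex" where
  "taylor_coeff f = (\<lambda>(i, j).
     (deriv ^^ i) (\<lambda>z. (deriv ^^ j) (\<lambda>w. f (z, w)) 0) 0 / (fact i * fact j))"

definition H2 :: "(complex \<times> complex \<Rightarrow> complex) set" where
  "H2 = {f. holomorphic_bidisk f \<and> (\<lambda>ij. (cmod (taylor_coeff f ij))\<^sup>2) summable_on UNIV}"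

definition H2_inner ::
    "(complex \<times> complex \<Rightarrow> complex) \<Rightarrow> (complex \<times> complex \<Rightarrow> complex) \<Rightarrow> complex" where
  "H2_inner f g = (\<Sum>\<^sub>\<infinity>ij. taylor_coeff f ij * cnj (taylor_coeff g ij))"

definition H2_norm :: "(complex \<times> complex \<Rightarrow> complex) \<Rightarrow> real" where
  "H2_norm f = sqrt (Re (H2_inner f f))"

text \<open>
  A polynomial in $z, w$ is an element of \<^typ>\<open>complex poly poly\<close>: the outer variable is $w$, the
  inner one is $z$, so \<^term>\<open>coeff (coeff q j) i\<close> is the coefficient of $z^i w^j$ and
  \<^term>\<open>smult [:c:] q\<close> is the scalar multiple of $q$ by the complex number $c$.
\<close>

definition bipoly :: "complex poly poly \<Rightarrow> complex \<times> complex \<Rightarrow> complex" where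
  "bipoly q = (\<lambda>(z, w). poly (poly q [:w:]) z)"

definition degree_z :: "complex poly poly \<Rightarrow> nat" where
  "degree_z q = Max ((\<lambda>j. degree (coeff q j)) ` {..degree q})"

definition degree_w :: "complex poly poly \<Rightarrow> nat" where
  "degree_w q = degree q"

text \<open>
  Coefficientwise form of the reflection; the lemma \<open>bipoly_reflection\<close> below is the formula
  $z^a w^b \overline{q(1/\overline{z}, 1/\overline{w})}$, where $(a,b)$ is the bi-degree of $q$.
\<close>

definition reflection :: "complex poly poly \<Rightarrow> complex poly poly" where
  "reflection q = (\<Sum>j\<le>degree_w q. \<Sum>i\<le>degree_z q.
     monom (monom (cnj (coeff (coeff q (degree_w q - j)) (degree_z q - i))) i) j)"

text \<open>
  Degree lexicographic enumeration of the monomials. The library's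
  \<^term>\<open>prod_encode (j, i) = triangle (j + i) + j\<close> is exactly the position of $z^i w^j$: there are
  \<^term>\<open>triangle (j + i)\<close> monomials of smaller total degree, and $j$ earlier ones of the same degree.
\<close>

definition chi :: "nat \<Rightarrow> complex poly poly" where
  "chi k = (case prod_decode k of (j, i) \<Rightarrow> monom (monom 1 i) j)"

definition polys_upto :: "nat \<Rightarrow> complex poly poly set" where
  "polys_upto n = range (\<lambda>c :: nat \<Rightarrow> complex. \<Sum>k\<le>n. smult [:c k:] (chi k))"

text \<open>Meaningful for \<open>g\<close> in \<^term>\<open>H2\<close> that does not vanish identically on the bidisk.\<close>

definition opa :: "nat \<Rightarrow> (complex \<times> complex \<Rightarrow> complex) \<Rightarrow> complex poly poly" where
  "opa n g = (THE p. p \<in> polys_upto n \<and>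
     (\<forall>r\<in>polys_upto n. H2_norm (\<lambda>x. bipoly p x * g x - 1) \<le> H2_norm (\<lambda>x. bipoly r x * g x - 1)))"

lemma chi_first:
  "bipoly (chi 0) (z, w) = 1" "bipoly (chi 1) (z, w) = z" "bipoly (chi 2) (z, w) = w"
  "bipoly (chi 3) (z, w) = z ^ 2" "bipoly (chi 4) (z, w) = z * w" "bipoly (chi 5) (z, w) = w ^ 2"
  by (simp_all add: chi_def bipoly_def poly_monom prod_decode_def prod_decode_aux.simps
      numeral_eq_Suc power2_eq_square)

lemma degree_coeff_le_degree_z: "degree (coeff q j) \<le> degree_z q"
proof (cases "j \<le> degree q")
  case True
  then show ?thesis unfolding degree_z_def by (intro Max_ge) auto
qed (simp add: coeff_eq_0)

lemma bipoly_eq_sum: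
  "bipoly q (z, w) = (\<Sum>j\<le>degree_w q. \<Sum>i\<le>degree_z q. coeff (coeff q j) i * z ^ i * w ^ j)"
proof -
  have "poly (coeff q j) z = (\<Sum>i\<le>degree_z q. coeff (coeff q j) i * z ^ i)" for j
    unfolding poly_altdef
    by (rule sum.mono_neutral_left) (auto simp: degree_coeff_le_degree_z coeff_eq_0 
        intro: order_trans[OF _ degree_coeff_le_degree_z])
  then show ?thesis
    by (simp add: bipoly_def degree_w_def poly_altdef[of q] poly_sum poly_power sum_distrib_right)
qed

lemma bipoly_reflection:
  assumes "z \<noteq> 0" "w \<noteq> 0"
  shows "bipoly (reflection q) (z, w) =
    z ^ degree_z q * w ^ degree_w q * cnj (bipoly q (1 / cnj z, 1 / cnj w))"
proof -
  let ?a = "degree_z q" and ?b = "degree_w q"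
  have sum_rev: "sum g {..m} = (\<Sum>j\<le>m. g (m - j))" for g :: "nat \<Rightarrow> complex" and m
    by (rule sum.reindex_bij_witness[where i = "\<lambda>j. m - j" and j = "\<lambda>j. m - j"]) auto
  have "bipoly (reflection q) (z, w) =
      (\<Sum>j\<le>?b. \<Sum>i\<le>?a. cnj (coeff (coeff q (?b - j)) (?a - i)) * z ^ i * w ^ j)"
    by (simp add: bipoly_def reflection_def poly_sum poly_monom poly_power)
  also have "\<dots> = (\<Sum>j\<le>?b. \<Sum>i\<le>?a. cnj (coeff (coeff q j) i) * z ^ (?a - i) * w ^ (?b - j))"
    by (rule trans[OF sum_rev], rule sum.cong[OF refl],
        rule trans[OF sum_rev], rule sum.cong[OF refl]) auto
  also have "\<dots> = z ^ ?a * w ^ ?b * cnj (bipoly q (1 / cnj z, 1 / cnj w))"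
    unfolding bipoly_eq_sum cnj_sum sum_distrib_left using assms
    by (intro sum.cong refl) (simp add: power_diff power_divide)
  finally show ?thesis .
qed

end

(*
  Multiplication by monomials is isometric on square-summable series, so for square-summable A the
  norms of q A and (reflection q) A are the same Gram sum of shifts of A. Dilation by r < 1 and
  Fatou's lemma extend this to every A with holomorphic sum, in particular to A = p ft for a
  polynomial p. Hence p f and p g, where g = (reflection q) ft, have the same norm for all p, and
  |p f - 1|^2 and |p g - 1|^2 differ only in the term linear in p(0,0). Scaling p by a constant
  matches the two minimisation problems.
*)
theory Submission
  imports Defs "HOL-Computational_Algebra.Polynomial_FPS"
begin

section \<open>Square-summable double series\<close>

text \<open>On the torus |q| = |reflection q|, which would give the norm identity at once if
  \<open>ft\<close> had boundary values. But \<open>ft\<close> is only holomorphic and need not lie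
  in \<open>H2\<close> (for instance q = 1 - z and ft = 1 / (1 - z)), so the identity is proved on
  coefficients, and even the square summability of \<open>g\<close> has to come out of the limit
  argument. Fatou yields only an inequality; equality follows because reversing a coefficient array
  inside a fixed box is an involution. Functions are replaced by formal double series, with w as the
  outer variable: there a polynomial multiplier acts by ring multiplication, and nonzero factors
  cancel. The price is the passage from the iterated derivatives in \<open>taylor_coeff\<close> to
  these series, for which the coefficient of w^j must be shown to be holomorphic in z.\<close>

definition cf :: "complex fps fps \<Rightarrow> nat \<times> nat \<Rightarrow> complex" where
  "cf A k = fps_nth (fps_nth A (snd k)) (fst k)"

definition const2 :: "complex \<Rightarrow> complex fps fps" where
  "const2 c = fps_const (fps_const c)"

definition mono2 :: "nat \<times> nat \<Rightarrow> complex fps fps" where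
  "mono2 k = fps_const (fps_X ^ fst k) * fps_X ^ snd k"

lemma fps2_eqI: "(\<And>k. cf A k = cf B k) \<Longrightarrow> A = B"
  by (auto simp: cf_def fps_eq_iff)

lemma cf_add [simp]: "cf (A + B) k = cf A k + cf B k"
  and cf_diff [simp]: "cf (A - B) k = cf A k - cf B k"
  and cf_zero [simp]: "cf 0 k = 0"
  and cf_one: "cf 1 k = (if k = 0 then 1 else 0)"
  and cf_const2_mult [simp]: "cf (const2 c * A) k = c * cf A k"
  by (auto simp: cf_def const2_def prod_eq_iff)

lemma cf_sum [simp]: "cf (\<Sum>x\<in>S. A x) k = (\<Sum>x\<in>S. cf (A x) k)"
  by (induction S rule: infinite_finite_induct) auto

lemma cf_mono2_mult:
  "cf (mono2 k * A) l = (if fst k \<le> fst l \<and> snd k \<le> snd l then cf A (l - k) else 0)"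
proof -
  have eq: "mono2 k * A = fps_const (fps_X ^ fst k) * (fps_X ^ snd k * A)"
    by (simp add: mono2_def mult.assoc)
  show ?thesis
    by (auto simp: cf_def eq fps_X_power_mult_nth not_less)
qed

lemma mono2_add: "mono2 (k + l) = mono2 k * mono2 l"
  by (simp only: mono2_def fst_add snd_add power_add fps_const_mult[symmetric] mult.assoc mult.left_commute)

lemma const2_mult: "const2 (a * b) = const2 a * const2 b"
  and const2_diff: "const2 (a - b) = const2 a - const2 b"
  by (simp_all add: const2_def)

lemma summable_on_le:
  fixes f g :: "'a \<Rightarrow> real"
  assumes "g summable_on A" "\<And>x. x \<in> A \<Longrightarrow> f x \<le> g x" "\<And>x. x \<in> A \<Longrightarrow> 0 \<le> f x"
  shows "f summable_on A"
proof (rule nonneg_bdd_above_summable_on)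
  show "bdd_above (sum f ` {F. F \<subseteq> A \<and> finite F})"
  proof (rule bdd_aboveI2)
    fix F assume F: "F \<in> {F. F \<subseteq> A \<and> finite F}"
    then have "sum f F \<le> sum g F" using assms(2) by (intro sum_mono) auto
    also have "\<dots> \<le> infsum g A"
      using F assms by (intro finite_sum_le_infsum) (auto intro: order_trans)
    finally show "sum f F \<le> infsum g A" .
  qed
qed (use assms in auto)

lemma const2_minus_one: "const2 (-1) * A = - A"
  by (rule fps2_eqI) (simp add: cf_def const2_def)

section \<open>Square summability, inner product and norm of formal double series\<close>

definition l2 :: "complex fps fps \<Rightarrow> bool" where
  "l2 A \<longleftrightarrow> (\<lambda>k. (cmod (cf A k))\<^sup>2) summable_on UNIV"

text \<open>Holds without a summability hypothesis: if \<open>f\<close> is not summable, neither is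
  its complex embedding, and both sums take the default value 0.\<close>

lemma infsum_of_real: "(\<Sum>\<^sub>\<infinity>x\<in>A. complex_of_real (f x)) = of_real (\<Sum>\<^sub>\<infinity>x\<in>A. f x)"
proof (cases "f summable_on A")
  case True
  then show ?thesis
    by (intro infsumI has_sum_of_real has_sum_infsum)
next
  case False
  moreover have "\<not> (\<lambda>x. complex_of_real (f x)) summable_on A"
    using False summable_on_bounded_linear[OF bounded_linear_Re, of "\<lambda>x. complex_of_real (f x)" A]
    by (auto simp: o_def)
  ultimately show ?thesis by (simp add: infsum_not_exists)
qed

definition inner2 :: "complex fps fps \<Rightarrow> complex fps fps \<Rightarrow> complex" where
  "inner2 A B = (\<Sum>\<^sub>\<infinity>k. cf A k * cnj (cf B k))"

definition nsq :: "complex fps fps \<Rightarrow> real" where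
  "nsq A = (\<Sum>\<^sub>\<infinity>k. (cmod (cf A k))\<^sup>2)"

lemma l2_summable:
  assumes "l2 A" "l2 B"
  shows "(\<lambda>k. cf A k * cnj (cf B k)) summable_on UNIV"
proof -
  have "(\<lambda>k. (cmod (cf A k))\<^sup>2 + (cmod (cf B k))\<^sup>2) summable_on UNIV"
    using assms unfolding l2_def by (rule summable_on_add)
  then have "(\<lambda>k. norm (cf A k * cnj (cf B k))) summable_on UNIV"
  proof (rule summable_on_le)
    fix k
    have "0 \<le> (cmod (cf A k) - cmod (cf B k))\<^sup>2" "0 \<le> cmod (cf A k) * cmod (cf B k)"
      "0 \<le> (cmod (cf A k))\<^sup>2" "0 \<le> (cmod (cf B k))\<^sup>2" by auto
    then show "norm (cf A k * cnj (cf B k)) \<le> (cmod (cf A k))\<^sup>2 + (cmod (cf B k))\<^sup>2"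
      unfolding norm_mult power2_diff complex_mod_cnj by linarith
  qed auto
  then show ?thesis by (rule abs_summable_summable)
qed

lemma l2_add: "l2 A \<Longrightarrow> l2 B \<Longrightarrow> l2 (A + B)"
proof -
  assume "l2 A" "l2 B"
  then have "(\<lambda>k. 2 * (cmod (cf A k))\<^sup>2 + 2 * (cmod (cf B k))\<^sup>2) summable_on UNIV"
    unfolding l2_def by (intro summable_on_add summable_on_cmult_right)
  then show ?thesis
    unfolding l2_def
  proof (rule summable_on_le)
    fix k
    have "(cmod (cf A k + cf B k))\<^sup>2 \<le> (cmod (cf A k) + cmod (cf B k))\<^sup>2"
      by (intro power_mono norm_triangle_ineq) auto
    moreover have "0 \<le> (cmod (cf A k) - cmod (cf B k))\<^sup>2" by simp
    ultimately show "(cmod (cf (A + B) k))\<^sup>2 \<le> 2 * (cmod (cf A k))\<^sup>2 + 2 * (cmod (cf B k))\<^sup>2"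
      by (simp add: power2_diff power2_sum)
  qed auto
qed

lemma l2_const2_mult: "l2 A \<Longrightarrow> l2 (const2 c * A)"
  unfolding l2_def by (simp add: norm_mult power_mult_distrib summable_on_cmult_right)

lemma l2_diff: "l2 A \<Longrightarrow> l2 B \<Longrightarrow> l2 (A - B)"
  using l2_add[of A "const2 (-1) * B"] l2_const2_mult[of B "-1"]
  by (simp add: const2_minus_one)

lemma l2_zero: "l2 0"
  by (simp add: l2_def)

lemma l2_one: "l2 1"
proof -
  have "(\<lambda>k. (cmod (cf 1 k))\<^sup>2) summable_on {0}"
    by simp
  then show ?thesis
    unfolding l2_def by (rule summable_on_cong_neutral[THEN iffD1, rotated -1]) (auto simp: cf_one)
qed

lemma l2_sum: "(\<And>x. x \<in> S \<Longrightarrow> l2 (A x)) \<Longrightarrow> l2 (\<Sum>x\<in>S. A x)"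
  by (induction S rule: infinite_finite_induct) (auto intro: l2_zero l2_add)

lemma range_add_prod: "range (\<lambda>l. k + l) = {l :: nat \<times> nat. fst k \<le> fst l \<and> snd k \<le> snd l}"
  by (auto simp: image_iff prod_eq_iff le_iff_add)

lemma l2_mono2_mult:
  assumes "l2 A" shows "l2 (mono2 k * A)"
proof -
  have "(\<lambda>l. (cmod (cf A l))\<^sup>2) = (\<lambda>l. (cmod (cf (mono2 k * A) l))\<^sup>2) \<circ> (\<lambda>l. k + l)"
    by (auto simp: cf_mono2_mult fun_eq_iff)
  then have "(\<lambda>l. (cmod (cf (mono2 k * A) l))\<^sup>2) summable_on range (\<lambda>l. k + l)"
    using assms by (subst summable_on_reindex) (auto simp: l2_def inj_on_def)
  then show ?thesis
    unfolding l2_def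
    by (rule summable_on_cong_neutral[THEN iffD1, rotated -1])
       (auto simp: cf_mono2_mult range_add_prod)
qed

text \<open>Both products are supported on the translate of the index set by \<open>k\<close>, and
  reindexing along this injective shift restores the original sum.\<close>

lemma inner2_mono2_mult: "inner2 (mono2 k * A) (mono2 k * B) = inner2 A B"
proof -
  have "inner2 (mono2 k * A) (mono2 k * B) =
      (\<Sum>\<^sub>\<infinity>l\<in>range (\<lambda>l. k + l). cf (mono2 k * A) l * cnj (cf (mono2 k * B) l))"
    unfolding inner2_def range_add_prod by (rule infsum_cong_neutral) (auto simp: cf_mono2_mult)
  also have "\<dots> = inner2 A B"
    by (subst infsum_reindex) (auto simp: inner2_def inj_on_def cf_mono2_mult o_def)
  finally show ?thesis .
qed

lemma inner2_add_left: "l2 A \<Longrightarrow> l2 B \<Longrightarrow> l2 D \<Longrightarrow> inner2 (A + B) D = inner2 A D + inner2 B D"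
  unfolding inner2_def by (simp add: distrib_right infsum_add l2_summable)

lemma inner2_const2_left: "inner2 (const2 c * A) D = c * inner2 A D"
  unfolding inner2_def by (simp add: mult.assoc infsum_cmult_right')

lemma inner2_cnj: "inner2 B A = cnj (inner2 A B)"
  unfolding inner2_def infsum_cnj[symmetric] by (simp only: complex_cnj_mult complex_cnj_cnj mult.commute)

lemma inner2_diff_left: "l2 A \<Longrightarrow> l2 B \<Longrightarrow> l2 D \<Longrightarrow> inner2 (A - B) D = inner2 A D - inner2 B D"
  using inner2_add_left[of "A - B" B D] by (simp add: l2_diff)

lemma inner2_zero_left [simp]: "inner2 0 D = 0"
  by (simp add: inner2_def)

lemma inner2_sum_left:
  "(\<And>x. x \<in> S \<Longrightarrow> l2 (A x)) \<Longrightarrow> l2 D \<Longrightarrow> inner2 (\<Sum>x\<in>S. A x) D = (\<Sum>x\<in>S. inner2 (A x) D)"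
  by (induction S rule: infinite_finite_induct) (auto simp: inner2_add_left l2_sum)

lemma inner2_add_right: "l2 A \<Longrightarrow> l2 B \<Longrightarrow> l2 D \<Longrightarrow> inner2 D (A + B) = inner2 D A + inner2 D B"
  by (simp add: inner2_cnj[of D] inner2_add_left)

lemma inner2_diff_right: "l2 A \<Longrightarrow> l2 B \<Longrightarrow> l2 D \<Longrightarrow> inner2 D (A - B) = inner2 D A - inner2 D B"
  by (simp add: inner2_cnj[of D] inner2_diff_left)

lemma inner2_const2_right: "inner2 D (const2 c * A) = cnj c * inner2 D A"
  by (simp add: inner2_cnj[of D] inner2_const2_left)

lemma inner2_sum_right:
  "(\<And>x. x \<in> S \<Longrightarrow> l2 (A x)) \<Longrightarrow> l2 D \<Longrightarrow> inner2 D (\<Sum>x\<in>S. A x) = (\<Sum>x\<in>S. inner2 D (A x))"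
  by (induction S rule: infinite_finite_induct) (auto simp: inner2_add_right l2_sum inner2_cnj[of D 0])

lemma inner2_self: "inner2 A A = of_real (nsq A)"
proof -
  have "inner2 A A = (\<Sum>\<^sub>\<infinity>k. complex_of_real ((cmod (cf A k))\<^sup>2))"
    unfolding inner2_def by (rule infsum_cong) (rule complex_norm_square[symmetric])
  then show ?thesis unfolding nsq_def by (simp only: infsum_of_real)
qed

lemma nsq_nonneg: "0 \<le> nsq A"
  unfolding nsq_def by (rule infsum_nonneg) auto

lemma nsq_eq_0:
  assumes "l2 A" "nsq A = 0"
  shows "A = 0"
proof (rule fps2_eqI)
  fix k
  have "(cmod (cf A k))\<^sup>2 = 0"
    using assms unfolding l2_def nsq_def by (intro nonneg_infsum_le_0D[where A = UNIV]) auto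
  then show "cf A k = cf 0 k" by simp
qed

lemma nsq_add:
  assumes "l2 A" "l2 B"
  shows "nsq (A + B) = nsq A + 2 * Re (inner2 A B) + nsq B"
proof -
  have "complex_of_real (nsq (A + B)) = nsq A + inner2 A B + cnj (inner2 A B) + nsq B"
    using assms by (simp add: inner2_add_left inner2_add_right l2_add inner2_cnj[of B A] flip: inner2_self)
  then have "Re (complex_of_real (nsq (A + B))) = Re (nsq A + inner2 A B + cnj (inner2 A B) + nsq B)"
    by (simp only:)
  then show ?thesis by simp
qed

lemma inner2_one_right: "inner2 A 1 = cf A 0"
proof -
  have "inner2 A 1 = (\<Sum>\<^sub>\<infinity>k\<in>{0}. cf A k * cnj (cf 1 k))"
    unfolding inner2_def by (rule infsum_cong_neutral) (auto simp: cf_one)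
  then show ?thesis by (simp add: cf_one)
qed

text \<open>The inner product with 1 reads off the constant coefficient, so the approximation error
  depends on \<open>A\<close> only through its norm and its value at the origin.\<close>

lemma nsq_diff_one:
  assumes "l2 A" shows "nsq (A - 1) = nsq A - 2 * Re (cf A 0) + 1"
proof -
  have "nsq A = nsq ((A - 1) + 1)" by simp
  also have "\<dots> = nsq (A - 1) + 2 * Re (cf A 0 - 1) + nsq 1"
    using assms by (subst nsq_add) (auto simp: l2_diff l2_one inner2_one_right cf_one)
  also have "nsq 1 = 1" using inner2_self[of 1] by (simp add: inner2_one_right cf_one)
  finally show ?thesis by simp
qed

text \<open>Gram--Schmidt: the vector added last is first replaced by its component orthogonal to the others.\<close>

lemma projection_exists:
  fixes n :: nat
  assumes "\<And>k. l2 (v k)" "l2 u"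
  shows "\<exists>c. \<forall>k<n. inner2 (u - (\<Sum>j<n. const2 (c j) * v j)) (v k) = 0"
  using assms(2)
proof (induction n arbitrary: u)
  case (Suc n)
  have l: "l2 (\<Sum>j<n. const2 (c j) * v j)" for c :: "nat \<Rightarrow> complex"
    using assms(1) by (intro l2_sum l2_const2_mult)
  obtain c where c: "\<forall>k<n. inner2 (u - (\<Sum>j<n. const2 (c j) * v j)) (v k) = 0"
    using Suc by blast
  obtain d where d: "\<forall>k<n. inner2 (v n - (\<Sum>j<n. const2 (d j) * v j)) (v k) = 0"
    using Suc.IH assms(1) by blast
  define x where "x = u - (\<Sum>j<n. const2 (c j) * v j)"
  define e where "e = v n - (\<Sum>j<n. const2 (d j) * v j)"
  have lx: "l2 x" "l2 e" unfolding x_def e_def using Suc.prems assms(1) l by (auto intro: l2_diff)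
  \<comment> \<open>If \<open>v n\<close> depends on the earlier vectors, then \<open>e = 0\<close>
    and division by zero gives \<open>t = 0\<close>; the identity \<open>te\<close> holds in that
    case too.\<close>
  define t where "t = inner2 x e / inner2 e e"
  have vn: "v n = e + (\<Sum>j<n. const2 (d j) * v j)" by (simp add: e_def)
  have te: "t * inner2 e e = inner2 x e"
  proof (cases "inner2 e e = 0")
    case True
    then have "e = 0" using nsq_eq_0 lx inner2_self by simp
    then show ?thesis by (simp add: inner2_cnj[of x 0])
  qed (simp add: t_def)
  \<comment> \<open>A vector orthogonal to the earlier \<open>v k\<close> sees \<open>v n\<close>
    only through its component \<open>e\<close>. This applies to both \<open>x\<close> and
    \<open>e\<close>.\<close>
  have perp: "inner2 y (v n) = inner2 y e" if "\<forall>k<n. inner2 y (v k) = 0" "l2 y" for y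
    using that assms(1) lx l unfolding vn
    by (simp add: inner2_add_right inner2_sum_right inner2_const2_right l2_const2_mult)
  \<comment> \<open>These are the coefficients of \<open>u - (x - t e)\<close> after
    \<open>e\<close> is rewritten in terms of the \<open>v j\<close>.\<close>
  define b where "b j = (if j = n then t else c j - t * d j)" for j
  have "u - (\<Sum>j<Suc n. const2 (b j) * v j) = x - const2 t * e"
    by (simp add: b_def x_def e_def sum_distrib_left const2_mult const2_diff algebra_simps
        sum_subtractf)
  moreover have "inner2 (x - const2 t * e) (v k) = 0" if "k < Suc n" for k
  proof -
    have "inner2 (x - const2 t * e) (v k) = inner2 x (v k) - t * inner2 e (v k)"
      using lx assms(1) by (simp add: inner2_diff_left l2_const2_mult inner2_const2_left)
    moreover have "k = n \<or> k < n" using that by auto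
    ultimately show ?thesis
      using perp[of x] perp[of e] c d lx te by (auto simp: x_def e_def)
  qed
  ultimately show ?case by metis
qed auto

section \<open>Reflecting a polynomial multiplier\<close>

text \<open>The series of A(r z, r w).\<close>

definition dil :: "real \<Rightarrow> complex fps fps \<Rightarrow> complex fps fps" where
  "dil r A = Abs_fps (\<lambda>j. Abs_fps (\<lambda>i. of_real r ^ (i + j) * fps_nth (fps_nth A j) i))"

lemma cf_dil: "cf (dil r A) k = of_real r ^ (fst k + snd k) * cf A k"
  by (simp add: cf_def dil_def)

text \<open>The index set is kept separate from the coefficients, so that reflection is reversal in
  a fixed box and stays an involution even when the reflected polynomial has smaller degree.\<close>

definition lincomb :: "(nat \<times> nat) set \<Rightarrow> (nat \<times> nat \<Rightarrow> complex) \<Rightarrow> complex fps fps" where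
  "lincomb K a = (\<Sum>k\<in>K. const2 (a k) * mono2 k)"

lemma lincomb_mult: "lincomb K a * A = (\<Sum>k\<in>K. const2 (a k) * (mono2 k * A))"
  by (simp add: lincomb_def sum_distrib_right mult.assoc)

lemma l2_lincomb_mult: "l2 A \<Longrightarrow> l2 (lincomb K a * A)"
  unfolding lincomb_mult by (intro l2_sum l2_const2_mult l2_mono2_mult)

text \<open>Dilation is multiplicative: the degree of \<open>l\<close> splits as that of
  \<open>k\<close> plus that of \<open>l - k\<close>. It therefore acts on a multiplier by weighting
  its coefficients.\<close>

lemma dil_lincomb_mult:
  "dil r (lincomb K a * A) = lincomb K (\<lambda>k. of_real r ^ (fst k + snd k) * a k) * dil r A"
  unfolding lincomb_mult
proof (rule fps2_eqI)
  fix l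
  have *: "of_real r ^ (fst l + snd l) * (a k * cf (mono2 k * A) l) =
      of_real r ^ (fst k + snd k) * a k * cf (mono2 k * dil r A) l" for k
  proof (cases "fst k \<le> fst l \<and> snd k \<le> snd l")
    case True
    then have "fst l + snd l = (fst k + snd k) + (fst (l - k) + snd (l - k))" by auto
    then have "of_real r ^ (fst l + snd l) = (of_real r :: complex) ^ (fst k + snd k) *
       of_real r ^ (fst (l - k) + snd (l - k))"
      by (metis power_add)
    with True show ?thesis by (simp add: cf_mono2_mult cf_dil)
  qed (auto simp: cf_mono2_mult)
  show "cf (dil r (\<Sum>k\<in>K. const2 (a k) * (mono2 k * A))) l =
      cf (\<Sum>k\<in>K. const2 (of_real r ^ (fst k + snd k) * a k) * (mono2 k * dil r A)) l"
    by (simp add: cf_dil sum_distrib_left * )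
qed

abbreviation box :: "nat \<times> nat \<Rightarrow> (nat \<times> nat) set" where
  "box m \<equiv> {..fst m} \<times> {..snd m}"

lemma box_reflect: "k \<in> box m \<Longrightarrow> m - (m - k) = k"
  by (auto simp: prod_eq_iff)

text \<open>
  On square-summable series, multiplication by a monomial is isometric, so both sides expand into
  the same Gram sums of monomial shifts.
\<close>

lemma nsq_reflect_l2:
  assumes "l2 A"
  shows "nsq (lincomb (box m) (\<lambda>k. cnj (a (m - k))) * A) = nsq (lincomb (box m) a * A)"
proof -
  let ?K = "box m"
  have expand: "inner2 (lincomb ?K b * A) (lincomb ?K b * A) =
      (\<Sum>k\<in>?K. \<Sum>l\<in>?K. b k * cnj (b l) * inner2 (mono2 k * A) (mono2 l * A))" for b
  proof -
    have l: "l2 (mono2 k * A)" "l2 (const2 c * (mono2 k * A))" "l2 (lincomb ?K b * A)" for c k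
      using assms by (auto intro: l2_const2_mult l2_mono2_mult l2_lincomb_mult)
    have r: "inner2 (mono2 k * A) (lincomb ?K b * A) =
        (\<Sum>l\<in>?K. cnj (b l) * inner2 (mono2 k * A) (mono2 l * A))" for k
      by (subst lincomb_mult, subst inner2_sum_right) (use l in \<open>auto simp: inner2_const2_right\<close>)
    have "inner2 (lincomb ?K b * A) (lincomb ?K b * A) =
        (\<Sum>k\<in>?K. b k * inner2 (mono2 k * A) (lincomb ?K b * A))"
      by (subst lincomb_mult, subst inner2_sum_left) (use l in \<open>auto simp: inner2_const2_left\<close>)
    then show ?thesis by (simp only: r sum_distrib_left mult.assoc)
  qed
  have rev: "(\<Sum>k\<in>?K. g k) = (\<Sum>k\<in>?K. g (m - k))" for g :: "nat \<times> nat \<Rightarrow> complex"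
    by (rule sum.reindex_bij_witness[where i = "\<lambda>k. m - k" and j = "\<lambda>k. m - k"])
       (use box_reflect in \<open>auto simp: mem_Times_iff\<close>)
  \<comment> \<open>Shifting both arguments by \<open>k + l\<close> turns the exponents
    \<open>m - k\<close> and \<open>m - l\<close> into \<open>m + l\<close> and
    \<open>m + k\<close>; the common shift by \<open>m\<close> is then removed. The exchange of
    \<open>k\<close> and \<open>l\<close> is what the conjugated coefficients compensate.\<close>
  have shift: "inner2 (mono2 (m - k) * A) (mono2 (m - l) * A) = inner2 (mono2 l * A) (mono2 k * A)"
    if "k \<in> ?K" "l \<in> ?K" for k l
  proof -
    have "k + l + (m - k) = m + l" "k + l + (m - l) = m + k"
      using that by (auto simp: prod_eq_iff)
    then have "mono2 (k + l) * mono2 (m - k) = mono2 m * mono2 l"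
      "mono2 (k + l) * mono2 (m - l) = mono2 m * mono2 k"
      by (simp_all flip: mono2_add)
    then have "inner2 (mono2 (k + l) * (mono2 (m - k) * A)) (mono2 (k + l) * (mono2 (m - l) * A)) =
      inner2 (mono2 m * (mono2 l * A)) (mono2 m * (mono2 k * A))"
      by (simp add: mult.assoc[symmetric])
    then show ?thesis by (simp add: inner2_mono2_mult)
  qed
  let ?b = "\<lambda>k. cnj (a (m - k))"
  have "inner2 (lincomb ?K ?b * A) (lincomb ?K ?b * A) =
      (\<Sum>k\<in>?K. \<Sum>l\<in>?K. ?b (m - k) * cnj (?b (m - l)) * inner2 (mono2 (m - k) * A) (mono2 (m - l) * A))"
    unfolding expand
    by (rule trans[OF rev], rule sum.cong[OF refl], rule trans[OF rev], rule refl)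
  also have "\<dots> = (\<Sum>k\<in>?K. \<Sum>l\<in>?K. a l * cnj (a k) * inner2 (mono2 l * A) (mono2 k * A))"
  proof (intro sum.cong refl)
    fix k l assume "k \<in> ?K" "l \<in> ?K"
    then show "?b (m - k) * cnj (?b (m - l)) * inner2 (mono2 (m - k) * A) (mono2 (m - l) * A) =
        a l * cnj (a k) * inner2 (mono2 l * A) (mono2 k * A)"
      by (simp only: box_reflect shift complex_cnj_cnj mult.commute[of "cnj (a k)"])
  qed
  also have "\<dots> = inner2 (lincomb ?K a * A) (lincomb ?K a * A)"
    unfolding expand by (rule sum.swap)
  finally show ?thesis by (simp add: inner2_self)
qed

text \<open>A substitute for convergence on the bidisk: it holds for the Taylor series of every
  holomorphic function there and survives multiplication by polynomials.\<close>

definition tame :: "complex fps fps \<Rightarrow> bool" where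
  "tame A \<longleftrightarrow> (\<forall>r. 0 < r \<and> r < 1 \<longrightarrow> l2 (dil r A))"

lemma tame_lincomb_mult: "tame A \<Longrightarrow> tame (lincomb K a * A)"
  unfolding tame_def dil_lincomb_mult by (auto intro: l2_lincomb_mult)

lemma nsq_dil_le:
  assumes "l2 A" "0 < r" "r < 1"
  shows "nsq (dil r A) \<le> nsq A"
proof -
  have le: "(cmod (cf (dil r A) k))\<^sup>2 \<le> (cmod (cf A k))\<^sup>2" for k
  proof -
    have "r ^ (fst k + snd k) \<le> 1" using assms by (intro power_le_one) auto
    then show ?thesis
      using assms by (intro power_mono) (auto simp: cf_dil norm_mult norm_power mult_le_cancel_right1 mult_left_le_one_le)
  qed
  have "(\<lambda>k. (cmod (cf (dil r A) k))\<^sup>2) summable_on UNIV"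
    using assms(1)[unfolded l2_def] by (rule summable_on_le) (use le in auto)
  then show ?thesis
    unfolding nsq_def using assms(1)[unfolded l2_def] le by (rule infsum_mono)
qed

text \<open>
  A dilation by \<open>r < 1\<close> makes everything square summable; then \<open>r \<longlongrightarrow> 1\<close> by Fatou, on finite
  partial sums.
\<close>

lemma nsq_reflect_le:
  assumes "tame A" "l2 (lincomb (box m) a * A)"
  shows "l2 (lincomb (box m) (\<lambda>k. cnj (a (m - k))) * A)"
    and "nsq (lincomb (box m) (\<lambda>k. cnj (a (m - k))) * A) \<le> nsq (lincomb (box m) a * A)"
proof -
  let ?K = "box m"
  define R where "R = lincomb ?K (\<lambda>k. cnj (a (m - k))) * A"
  define S where "S = nsq (lincomb ?K a * A)"
  \<comment> \<open>The multiplier is dilated first and reflected afterwards, so its weights are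
    powers of \<open>r\<close> with exponent the degree of \<open>m - k\<close>, not of
    \<open>k\<close>. Hence \<open>B r\<close> is not \<open>dil r R\<close>, but it converges to
    \<open>R\<close> coefficientwise.\<close>
  define B where "B r = lincomb ?K (\<lambda>k. cnj (of_real r ^ (fst (m - k) + snd (m - k)) * a (m - k))) * dil r A"
    for r
  have lB: "l2 (B r)" if "0 < r" "r < 1" for r
    using that assms(1) unfolding B_def tame_def by (intro l2_lincomb_mult) auto
  have nB: "nsq (B r) \<le> S" if "0 < r" "r < 1" for r
  proof -
    have "nsq (B r) = nsq (lincomb ?K (\<lambda>k. of_real r ^ (fst k + snd k) * a k) * dil r A)"
      unfolding B_def
      using that assms(1) by (intro nsq_reflect_l2[where a = "\<lambda>k. of_real r ^ (fst k + snd k) * a k"]) (auto simp: tame_def)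
    also have "\<dots> \<le> S"
      using nsq_dil_le[OF assms(2) that] by (simp add: dil_lincomb_mult S_def)
    finally show ?thesis .
  qed
  have lim: "((\<lambda>r. cf (B r) l) \<longlongrightarrow> cf R l) (at_left 1)" for l
  proof -
    have m: "((\<lambda>r. cf (mono2 k * dil r A) l) \<longlongrightarrow> cf (mono2 k * A) l) (at_left (1::real))" for k
      by (cases "fst k \<le> fst l \<and> snd k \<le> snd l")
         (auto simp: cf_mono2_mult cf_dil intro!: tendsto_eq_intros)
    have "((\<lambda>r. \<Sum>k\<in>?K. cnj (of_real r ^ (fst (m - k) + snd (m - k)) * a (m - k)) * cf (mono2 k * dil r A) l)
      \<longlongrightarrow> (\<Sum>k\<in>?K. cnj (of_real 1 ^ (fst (m - k) + snd (m - k)) * a (m - k)) * cf (mono2 k * A) l))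
      (at_left (1::real))"
      by (intro tendsto_sum tendsto_mult tendsto_cnj tendsto_power tendsto_of_real tendsto_ident_at tendsto_const m)
    then show ?thesis
      by (simp add: B_def R_def lincomb_mult )
  qed
  have fin: "(\<Sum>l\<in>F. (cmod (cf R l))\<^sup>2) \<le> S" if "finite F" for F
  proof (rule tendsto_upperbound)
    show "((\<lambda>r. \<Sum>l\<in>F. (cmod (cf (B r) l))\<^sup>2) \<longlongrightarrow> (\<Sum>l\<in>F. (cmod (cf R l))\<^sup>2)) (at_left 1)"
      by (intro tendsto_intros lim)
    have "eventually (\<lambda>r::real. 0 < r \<and> r < 1) (at_left 1)"
      using eventually_at_left_real[of 0 1] by (auto elim: eventually_mono)
    then show "\<forall>\<^sub>F r in at_left 1. (\<Sum>l\<in>F. (cmod (cf (B r) l))\<^sup>2) \<le> S"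
    proof (rule eventually_mono)
      fix r :: real assume r: "0 < r \<and> r < 1"
      have "(\<Sum>l\<in>F. (cmod (cf (B r) l))\<^sup>2) \<le> nsq (B r)"
        using lB[of r] r that unfolding nsq_def l2_def by (intro finite_sum_le_infsum) auto
      then show "(\<Sum>l\<in>F. (cmod (cf (B r) l))\<^sup>2) \<le> S" using nB[of r] r by simp
    qed
  qed simp
  have sm: "(\<lambda>l. (cmod (cf R l))\<^sup>2) summable_on UNIV"
    by (rule nonneg_bdd_above_summable_on) (auto intro!: bdd_aboveI2[where M = S] fin)
  then show "l2 (lincomb ?K (\<lambda>k. cnj (a (m - k))) * A)" by (simp add: l2_def R_def)
  show "nsq (lincomb ?K (\<lambda>k. cnj (a (m - k))) * A) \<le> nsq (lincomb ?K a * A)"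
    using infsum_le_finite_sums[OF sm fin] by (simp add: nsq_def R_def S_def)
qed

text \<open>Reflecting twice in the same box gives back \<open>a\<close>, so the inequality can be
  applied once more to the reflected array, whose product with \<open>A\<close> is already known to
  be square summable.\<close>

lemma nsq_reflect:
  assumes "tame A" "l2 (lincomb (box m) a * A)"
  shows "nsq (lincomb (box m) (\<lambda>k. cnj (a (m - k))) * A) = nsq (lincomb (box m) a * A)"
proof -
  have "lincomb (box m) (\<lambda>k. cnj (cnj (a (m - (m - k))))) = lincomb (box m) a"
    unfolding lincomb_def by (intro sum.cong refl) (simp only: box_reflect complex_cnj_cnj)
  then show ?thesis
    using nsq_reflect_le[OF assms]
      nsq_reflect_le(2)[OF assms(1), of m "\<lambda>k. cnj (a (m - k))"] by simp
qed

section \<open>Taylor series on the bidisk\<close>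

definition wcoeff :: "(complex \<times> complex \<Rightarrow> complex) \<Rightarrow> nat \<Rightarrow> complex \<Rightarrow> complex" where
  "wcoeff g j z = (deriv ^^ j) (\<lambda>w. g (z, w)) 0 / fact j"

text \<open>Cauchy's inequality on the circle of radius \<open>s\<close> in w; a bound for
  \<open>g\<close> on the compact bidisk of radius \<open>s\<close> makes the estimate uniform in
  z.\<close>

lemma wcoeff_bound:
  assumes "holomorphic_bidisk g" "0 < s" "s < 1"
  obtains M where "0 \<le> M" "\<And>j z. cmod z \<le> s \<Longrightarrow> cmod (wcoeff g j z) \<le> M / s ^ j"
proof -
  have sub: "cball 0 s \<times> cball 0 s \<subseteq> bidisk"
    using assms by (auto simp: bidisk_def)
  have "compact (g ` (cball 0 s \<times> cball 0 s))"
    using assms(1) sub unfolding holomorphic_bidisk_def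
    by (intro compact_continuous_image compact_Times compact_cball) (auto intro: continuous_on_subset)
  then obtain M where M: "\<And>x. x \<in> cball 0 s \<times> cball 0 s \<Longrightarrow> cmod (g x) \<le> M"
    by (meson compact_imp_bounded bounded_iff imageI)
  have "(0, 0) \<in> cball (0 :: complex) s \<times> cball (0 :: complex) s" using assms by auto
  from order_trans[OF norm_ge_zero M[OF this]] have "0 \<le> M" .
  moreover have "cmod (wcoeff g j z) \<le> M / s ^ j" if z: "cmod z \<le> s" for j z
  proof -
    have h: "(\<lambda>w. g (z, w)) holomorphic_on ball 0 1"
      using assms z unfolding holomorphic_bidisk_def by auto
    have "cmod ((deriv ^^ j) (\<lambda>w. g (z, w)) 0) \<le> fact j * M / s ^ j"
    proof (rule Cauchy_inequality)
      show "(\<lambda>w. g (z, w)) holomorphic_on ball 0 s"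
        by (rule holomorphic_on_subset[OF h]) (use assms in auto)
      show "continuous_on (cball 0 s) (\<lambda>w. g (z, w))"
        by (rule holomorphic_on_imp_continuous_on, rule holomorphic_on_subset[OF h]) (use assms in auto)
      show "cmod (g (z, w)) \<le> M" if "cmod (0 - w) = s" for w
        using M[of "(z, w)"] z that by auto
    qed (use assms in auto)
    then show ?thesis by (simp add: wcoeff_def norm_divide field_simps)
  qed
  ultimately show ?thesis by (rule that)
qed

lemma wcoeff_sums:
  assumes "holomorphic_bidisk g" "cmod z < 1" "cmod w < 1"
  shows "(\<lambda>k. wcoeff g k z * w ^ k) sums g (z, w)"
proof -
  have "(\<lambda>w. g (z, w)) holomorphic_on ball 0 1"
    using assms unfolding holomorphic_bidisk_def by auto
  from holomorphic_power_series[OF this, of w] assms(3) show ?thesis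
    by (simp add: wcoeff_def)
qed

text \<open>
  By induction on \<open>j\<close>: the coefficient of \<open>w ^ j\<close> is the locally uniform limit, as \<open>w \<longlongrightarrow> 0\<close>, of the
  Taylor remainders of order \<open>j\<close> divided by \<open>w ^ j\<close>.
\<close>

lemma wcoeff_holomorphic_ball:
  assumes "holomorphic_bidisk g" "0 < s" "s < 1"
  shows "wcoeff g j holomorphic_on ball 0 s"
proof (induction j rule: less_induct)
  case (less j)
  obtain M where M: "0 \<le> M" "\<And>j z. cmod z \<le> s \<Longrightarrow> cmod (wcoeff g j z) \<le> M / s ^ j"
    using wcoeff_bound assms by blast
  \<comment> \<open>Since |w n| = s * x n, the Cauchy bounds M / s^k make the tail after the j-th
    term geometric with ratio \<open>x n\<close>. Keeping \<open>x n \<le> 1/2\<close> bounds the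
    factor 1 / (1 - x n) by 2.\<close>
  define x :: "nat \<Rightarrow> real" where "x n = (1/2) ^ Suc n" for n
  define w :: "nat \<Rightarrow> complex" where "w n = of_real (s * x n)" for n
  have x: "0 < x n" "x n \<le> 1/2" for n
    using power_le_one[of "1/2::real" n] by (auto simp: x_def)
  have nw: "cmod (w n) = s * x n" "w n \<noteq> 0" for n
    using assms x[of n] by (auto simp: w_def norm_mult)
  have w1: "cmod (w n) < 1" for n
  proof -
    have "s * x n \<le> s" using assms x[of n] by (intro mult_left_le) auto
    then show ?thesis unfolding nw using assms by linarith
  qed
  define f where "f n z = (g (z, w n) - (\<Sum>k<j. wcoeff g k z * w n ^ k)) / w n ^ j" for n z
  have err: "cmod (f n z - wcoeff g j z) \<le> 2 * M / s ^ j * x n" if z: "cmod z \<le> s" for n z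
  proof -
    have "(\<lambda>k. wcoeff g k z * w n ^ k) sums g (z, w n)"
      using wcoeff_sums assms z w1 by auto
    then have "(\<lambda>m. wcoeff g (m + j) z * w n ^ (m + j)) sums (g (z, w n) - (\<Sum>k<j. wcoeff g k z * w n ^ k))"
      by (rule sums_split_initial_segment)
    from sums_divide[OF this, of "w n ^ j"]
    have "(\<lambda>m. wcoeff g (m + j) z * w n ^ m) sums f n z"
      using nw(2) by (simp add: f_def power_add)
    \<comment> \<open>The term with m = 0 is \<open>wcoeff g j z\<close> itself; removing it leaves
      the error.\<close>
    then have A: "(\<lambda>m. wcoeff g (Suc m + j) z * w n ^ Suc m) sums (f n z - wcoeff g j z)"
      by (subst sums_Suc_iff) simp
    have B: "cmod (wcoeff g (Suc m + j) z * w n ^ Suc m) \<le> M / s ^ j * x n * x n ^ m" for m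
    proof -
      have "cmod (wcoeff g (Suc m + j) z * w n ^ Suc m) \<le> M / s ^ (Suc m + j) * (s * x n) ^ Suc m"
        unfolding norm_mult norm_power nw using assms x[of n]
        by (intro mult_right_mono M z) auto
      also have "\<dots> = M / s ^ j * x n * x n ^ m"
        using assms by (simp add: power_add power_mult_distrib)
      finally show ?thesis .
    qed
    have C: "(\<lambda>m. M / s ^ j * x n * x n ^ m) sums (M / s ^ j * x n * (1 / (1 - x n)))"
      using x[of n] by (intro sums_mult geometric_sums) auto
    have "cmod (f n z - wcoeff g j z) \<le> M / s ^ j * x n * (1 / (1 - x n))"
      using B by (rule norm_sums_le[OF A C])
    also have "\<dots> \<le> M / s ^ j * x n * 2"
      using x[of n] M(1) assms by (intro mult_left_mono) (auto simp: field_simps)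
    finally show ?thesis by (simp add: mult_ac)
  qed
  show ?case
  proof (rule holomorphic_uniform_sequence)
    show "f n holomorphic_on ball 0 s" for n
    proof -
      have "(\<lambda>z. g (z, w n)) holomorphic_on ball 0 1"
        using assms w1 unfolding holomorphic_bidisk_def by auto
      then have "(\<lambda>z. g (z, w n)) holomorphic_on ball 0 s"
        by (rule holomorphic_on_subset) (use assms in auto)
      then show ?thesis
        unfolding f_def using less nw by (intro holomorphic_intros) auto
    qed
    show "\<exists>d>0. cball y d \<subseteq> ball 0 s \<and> uniform_limit (cball y d) f (wcoeff g j) sequentially"
      if y: "y \<in> ball 0 s" for y
    proof -
      obtain d where d: "d > 0" "cball y d \<subseteq> ball 0 s"
        using open_contains_cball[THEN iffD1, OF open_ball, rule_format, OF y] by blast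
      have "x \<longlonglongrightarrow> 0"
        unfolding x_def by (rule LIMSEQ_Suc) (rule LIMSEQ_power_zero, simp)
      then have lim: "(\<lambda>n. 2 * M / s ^ j * x n) \<longlonglongrightarrow> 0"
        by (rule tendsto_mult_right_zero)
      have "uniform_limit (cball y d) f (wcoeff g j) sequentially"
      proof (rule uniform_limitI)
        fix e :: real assume "0 < e"
        with lim have "\<forall>\<^sub>F n in sequentially. 2 * M / s ^ j * x n < e"
          by (rule order_tendstoD)
        then show "\<forall>\<^sub>F n in sequentially. \<forall>z\<in>cball y d. dist (f n z) (wcoeff g j z) < e"
        proof (rule eventually_mono, intro ballI)
          fix n z assume "2 * M / s ^ j * x n < e" "z \<in> cball y d"
          moreover have "cmod z \<le> s" using d \<open>z \<in> cball y d\<close> by auto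
          ultimately show "dist (f n z) (wcoeff g j z) < e"
            using err[of z n] by (simp add: dist_norm)
        qed
      qed
      with d show ?thesis by blast
    qed
  qed simp
qed

text \<open>The Cauchy bounds need a compact subset of the bidisk, so holomorphy is known on each
  smaller ball; these balls cover the disk.\<close>

lemma wcoeff_holomorphic:
  assumes "holomorphic_bidisk g"
  shows "wcoeff g j holomorphic_on ball 0 1"
proof -
  have "\<exists>r. 0 < r \<and> r < 1 \<and> z \<in> ball 0 r" if "z \<in> ball 0 1" for z :: complex
    using that by (intro exI[of _ "(1 + cmod z) / 2"]) (auto simp: add_pos_nonneg)
  then have "ball (0 :: complex) 1 \<subseteq> (\<Union>r\<in>{0<..<1}. ball 0 r)"
    unfolding subset_iff UN_iff Bex_def greaterThanLessThan_iff by blast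
  moreover have "wcoeff g j holomorphic_on (\<Union>r\<in>{0<..<1}. ball 0 r)"
    using assms wcoeff_holomorphic_ball by (intro holomorphic_on_UN_open) auto
  ultimately show ?thesis by (rule holomorphic_on_subset[rotated])
qed

section \<open>Iterated expansions and their uniqueness\<close>

definition bi_taylor :: "(complex \<times> complex \<Rightarrow> complex) \<Rightarrow> complex fps fps" where
  "bi_taylor g = Abs_fps (\<lambda>j. Abs_fps (\<lambda>i. taylor_coeff g (i, j)))"

lemma cf_bi_taylor: "cf (bi_taylor g) k = taylor_coeff g k"
  by (cases k) (simp add: cf_def bi_taylor_def)

text \<open>Mirrors the order of differentiation in \<open>taylor_coeff\<close>: first expand in w
  for fixed z, then expand each coefficient in z. The first expansion is required for all z in the
  disk because the outer derivatives at 0 need a whole neighbourhood.\<close>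

definition has_bi_expansion ::
    "(complex \<times> complex \<Rightarrow> complex) \<Rightarrow> complex fps fps \<Rightarrow> bool" where
  "has_bi_expansion g G \<longleftrightarrow> (\<exists>c.
     (\<forall>z\<in>ball 0 1. (\<lambda>w. g (z, w)) has_fps_expansion Abs_fps (c z)) \<and>
     (\<forall>j. (\<lambda>z. c z j) has_fps_expansion fps_nth G j))"

text \<open>Near z = 0 the inner derivative equals \<open>fact j * c z j\<close>, so the outer
  derivatives agree as well. Taylor coefficients of p g - 1 can thus be found by algebra on
  series.\<close>

lemma has_bi_expansion_unique:
  assumes "has_bi_expansion g G"
  shows "bi_taylor g = G"
proof (rule fps2_eqI)
  fix k :: "nat \<times> nat"
  obtain i j where k: "k = (i, j)" by (cases k)
  obtain c where c: "\<And>z. z \<in> ball 0 1 \<Longrightarrow> (\<lambda>w. g (z, w)) has_fps_expansion Abs_fps (c z)"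
    "\<And>j. (\<lambda>z. c z j) has_fps_expansion fps_nth G j"
    using assms unfolding has_bi_expansion_def by blast
  have "(deriv ^^ j) (\<lambda>w. g (z, w)) 0 = fact j * c z j" if "z \<in> ball 0 1" for z
    using fps_nth_fps_expansion[OF c(1)[OF that], of j] by simp
  moreover have "eventually (\<lambda>z. z \<in> ball 0 1) (nhds (0 :: complex))"
    by (intro eventually_nhds_in_open) auto
  ultimately have "(deriv ^^ i) (\<lambda>z. (deriv ^^ j) (\<lambda>w. g (z, w)) 0) 0 =
      (deriv ^^ i) (\<lambda>z. fact j * c z j) 0"
    by (intro higher_deriv_cong_ev) (auto elim: eventually_mono)
  also have "\<dots> = fact i * (fact j * cf G k)"
    using fps_nth_fps_expansion[OF has_fps_expansion_cmult_left[OF c(2)], of "fact j" j i]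
    by (simp add: cf_def k)
  finally show "cf (bi_taylor g) k = cf G k"
    by (simp add: cf_bi_taylor taylor_coeff_def k)
qed

lemma has_bi_expansion_wcoeff:
  assumes "holomorphic_bidisk g"
  shows "has_bi_expansion g (Abs_fps (\<lambda>j. fps_expansion (wcoeff g j) 0))"
  unfolding has_bi_expansion_def
proof (intro exI[of _ "\<lambda>z j. wcoeff g j z"] conjI ballI allI)
  fix z :: complex assume "z \<in> ball 0 1"
  then have "(\<lambda>w. g (z, w)) has_fps_expansion fps_expansion (\<lambda>w. g (z, w)) 0"
    using assms unfolding holomorphic_bidisk_def
    by (intro has_fps_expansion_fps_expansion[of "ball 0 1"]) auto
  then show "(\<lambda>w. g (z, w)) has_fps_expansion Abs_fps (\<lambda>j. wcoeff g j z)"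
    by (simp add: fps_expansion_def wcoeff_def)
next
  fix j
  have "wcoeff g j has_fps_expansion fps_expansion (wcoeff g j) 0"
    using wcoeff_holomorphic[OF assms] by (intro has_fps_expansion_fps_expansion[of "ball 0 1"]) auto
  then show "wcoeff g j has_fps_expansion fps_nth (Abs_fps (\<lambda>j. fps_expansion (wcoeff g j) 0)) j"
    by simp
qed

lemma bi_taylor_wcoeff:
  "holomorphic_bidisk g \<Longrightarrow> bi_taylor g = Abs_fps (\<lambda>j. fps_expansion (wcoeff g j) 0)"
  by (rule has_bi_expansion_unique[OF has_bi_expansion_wcoeff])

lemma has_bi_expansion_bi_taylor: "holomorphic_bidisk g \<Longrightarrow> has_bi_expansion g (bi_taylor g)"
  using has_bi_expansion_wcoeff bi_taylor_wcoeff by simp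

lemma has_bi_expansion_cong:
  assumes "has_bi_expansion g G" "\<And>z w. (z, w) \<in> bidisk \<Longrightarrow> h (z, w) = g (z, w)"
  shows "has_bi_expansion h G"
proof -
  have "(\<lambda>w. h (z, w)) has_fps_expansion F"
    if "(\<lambda>w. g (z, w)) has_fps_expansion F" "z \<in> ball 0 1" for z F
  proof -
    have "eventually (\<lambda>w. w \<in> ball 0 1) (nhds (0 :: complex))"
      by (intro eventually_nhds_in_open) auto
    then have "eventually (\<lambda>w. h (z, w) = g (z, w)) (nhds 0)"
      by (rule eventually_mono) (use assms(2) that in \<open>auto simp: bidisk_def\<close>)
    then show ?thesis using that(1) by (subst has_fps_expansion_cong) auto
  qed
  then show ?thesis using assms(1) unfolding has_bi_expansion_def by blast
qed

lemma has_bi_expansion_diff_one: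
  assumes "has_bi_expansion g G"
  shows "has_bi_expansion (\<lambda>x. g x - 1) (G - 1)"
proof -
  obtain c where c: "\<And>z. z \<in> ball 0 1 \<Longrightarrow> (\<lambda>w. g (z, w)) has_fps_expansion Abs_fps (c z)"
    "\<And>j. (\<lambda>z. c z j) has_fps_expansion fps_nth G j"
    using assms unfolding has_bi_expansion_def by blast
  define d where "d z j = c z j - fps_nth 1 j" for z j
  have "Abs_fps (d z) = Abs_fps (c z) - 1" for z
    by (simp add: fps_eq_iff d_def)
  then have "(\<lambda>w. g (z, w) - 1) has_fps_expansion Abs_fps (d z)" if "z \<in> ball 0 1" for z
    using c(1)[OF that] by (simp add: has_fps_expansion_diff)
  moreover have "(\<lambda>z. d z j) has_fps_expansion fps_nth (G - 1) j" for j
  proof -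
    have "(\<lambda>z. c z j - fps_nth 1 j) has_fps_expansion fps_nth G j - fps_const (fps_nth 1 j)"
      by (intro fps_expansion_intros c has_fps_expansion_const)
    \<comment> \<open>The coefficients of the outer unit series are themselves the inner series 0 or
      1.\<close>
    moreover have "fps_const (fps_nth (1 :: complex fps) j) = fps_nth 1 j"
      by (auto simp: fps_eq_iff)
    ultimately show ?thesis by (simp add: d_def)
  qed
  ultimately show ?thesis unfolding has_bi_expansion_def by blast
qed

section \<open>Polynomial multipliers and growth of Taylor coefficients\<close>

definition fps2_of_poly :: "complex poly poly \<Rightarrow> complex fps fps" where
  "fps2_of_poly p = Abs_fps (\<lambda>j. fps_of_poly (coeff p j))"

lemma poly_has_fps_expansion: "poly r has_fps_expansion fps_of_poly r" for r :: "complex poly"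
  by (simp add: has_fps_expansion_def)

lemma bipoly_eq_poly_map_poly: "bipoly p (z, w) = poly (map_poly (\<lambda>r. poly r z) p) w"
  by (simp add: bipoly_def, induction p) (auto simp: map_poly_pCons)

text \<open>For fixed z this is a Cauchy product in w; its j-th coefficient is a finite sum of
  products of functions of z, each with a known expansion.\<close>

lemma has_bi_expansion_bipoly_mult:
  assumes "has_bi_expansion g G"
  shows "has_bi_expansion (\<lambda>x. bipoly p x * g x) (fps2_of_poly p * G)"
proof -
  obtain c where c: "\<And>z. z \<in> ball 0 1 \<Longrightarrow> (\<lambda>w. g (z, w)) has_fps_expansion Abs_fps (c z)"
    "\<And>j. (\<lambda>z. c z j) has_fps_expansion fps_nth G j"
    using assms unfolding has_bi_expansion_def by blast
  define d where "d z j = (\<Sum>b=0..j. poly (coeff p b) z * c z (j - b))" for z j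
  have "Abs_fps (d z) = fps_of_poly (map_poly (\<lambda>r. poly r z) p) * Abs_fps (c z)" for z
    by (simp add: fps_eq_iff d_def fps_mult_nth coeff_map_poly)
  moreover have "(\<lambda>w. bipoly p (z, w)) has_fps_expansion fps_of_poly (map_poly (\<lambda>r. poly r z) p)" for z
    unfolding bipoly_eq_poly_map_poly by (rule poly_has_fps_expansion)
  ultimately have "(\<lambda>w. bipoly p (z, w) * g (z, w)) has_fps_expansion Abs_fps (d z)"
    if "z \<in> ball 0 1" for z
    using c(1)[OF that] by (auto intro!: has_fps_expansion_mult)
  moreover have "(\<lambda>z. d z j) has_fps_expansion fps_nth (fps2_of_poly p * G) j" for j
    unfolding d_def fps_mult_nth fps2_of_poly_def fps_nth_Abs_fps
    by (intro has_fps_expansion_sum has_fps_expansion_mult poly_has_fps_expansion c)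
  ultimately show ?thesis unfolding has_bi_expansion_def by blast
qed

lemma summable_on_geometric2:
  fixes x :: real
  assumes "0 \<le> x" "x < 1"
  shows "(\<lambda>k. x ^ (fst k + snd k)) summable_on (UNIV :: (nat \<times> nat) set)"
proof -
  have h: "((\<lambda>j. x ^ (i + j)) has_sum (x ^ i * (1 / (1 - x)))) UNIV" for i
    unfolding power_add using assms
    by (intro has_sum_cmult_right sums_nonneg_imp_has_sum geometric_sums) auto
  have "(\<lambda>(i, j). x ^ (i + j)) summable_on (SIGMA i:UNIV. UNIV)"
  proof (rule summable_on_SigmaI)
    show "(\<lambda>i. x ^ i * (1 / (1 - x))) summable_on UNIV"
      using h[of 0] by (intro summable_on_cmult_left) (auto simp: summable_on_def)
  qed (use h assms in auto)
  then show ?thesis by (simp add: case_prod_unfold)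
qed

text \<open>Cauchy's inequality in w and then in z, at a radius \<open>s\<close> strictly between
  \<open>r\<close> and 1, bounds the coefficients by M / s^(i + j). After dilation they decay
  geometrically with ratio r / s.\<close>

lemma tame_bi_taylor:
  assumes "holomorphic_bidisk g"
  shows "tame (bi_taylor g)"
  unfolding tame_def
proof (intro allI impI)
  fix r :: real assume r: "0 < r \<and> r < 1"
  define s where "s = (1 + r) / 2"
  have s: "0 < s" "s < 1" "r < s" using r by (auto simp: s_def)
  obtain M where M: "0 \<le> M" "\<And>j z. cmod z \<le> s \<Longrightarrow> cmod (wcoeff g j z) \<le> M / s ^ j"
    using wcoeff_bound assms s by blast
  define x where "x = (r / s)\<^sup>2"
  have x: "0 \<le> x" "x < 1" using r s by (auto simp: x_def power_less_one_iff)
  have "(cmod (cf (dil r (bi_taylor g)) k))\<^sup>2 \<le> M\<^sup>2 * x ^ (fst k + snd k)" for k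
  proof -
    obtain i j where k: "k = (i, j)" by (cases k)
    have "cmod ((deriv ^^ i) (wcoeff g j) 0) \<le> fact i * (M / s ^ j) / s ^ i"
    proof (rule Cauchy_inequality)
      show "wcoeff g j holomorphic_on ball 0 s"
        using wcoeff_holomorphic_ball assms s by blast
      show "continuous_on (cball 0 s) (wcoeff g j)"
        by (rule holomorphic_on_imp_continuous_on,
            rule holomorphic_on_subset[OF wcoeff_holomorphic[OF assms]]) (use s in auto)
    qed (use s M in auto)
    then have "cmod (cf (bi_taylor g) k) \<le> M / s ^ (i + j)"
      by (simp add: bi_taylor_wcoeff[OF assms] k cf_def fps_expansion_def norm_divide power_add field_simps)
    then have "cmod (cf (dil r (bi_taylor g)) k) \<le> r ^ (i + j) * (M / s ^ (i + j))"
      using r unfolding cf_dil norm_mult norm_power k fst_conv snd_conv norm_of_real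
      by (intro mult_mono) auto
    also have "\<dots> = M * (r / s) ^ (i + j)"
      by (simp add: power_divide)
    finally have "(cmod (cf (dil r (bi_taylor g)) k))\<^sup>2 \<le> (M * (r / s) ^ (i + j))\<^sup>2"
      by (intro power_mono) auto
    then show ?thesis by (simp add: x_def k power_mult_distrib power_mult[symmetric] mult.commute)
  qed
  moreover have "(\<lambda>k. M\<^sup>2 * x ^ (fst k + snd k)) summable_on (UNIV :: (nat \<times> nat) set)"
    using x by (intro summable_on_cmult_right summable_on_geometric2)
  ultimately show "l2 (dil r (bi_taylor g))"
    unfolding l2_def by (auto intro: summable_on_le)
qed

section \<open>Optimal approximants\<close>

lemma cf_fps2_of_poly: "cf (fps2_of_poly p) k = coeff (coeff p (snd k)) (fst k)"
  by (simp add: cf_def fps2_of_poly_def)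

lemma fps2_of_poly_eq_iff: "fps2_of_poly p = fps2_of_poly r \<longleftrightarrow> p = r"
proof
  assume "fps2_of_poly p = fps2_of_poly r"
  then have "cf (fps2_of_poly p) (i, j) = cf (fps2_of_poly r) (i, j)" for i j by simp
  then show "p = r" by (intro poly_eqI) (simp add: cf_fps2_of_poly)
qed simp

lemma fps2_of_poly_zero [simp]: "fps2_of_poly 0 = 0"
  and fps2_of_poly_add: "fps2_of_poly (p + r) = fps2_of_poly p + fps2_of_poly r"
  and fps2_of_poly_diff: "fps2_of_poly (p - r) = fps2_of_poly p - fps2_of_poly r"
  and fps2_of_poly_smult: "fps2_of_poly (smult [:c:] p) = const2 c * fps2_of_poly p"
  by (auto intro!: fps2_eqI simp: cf_fps2_of_poly)

lemma fps2_of_poly_sum: "fps2_of_poly (\<Sum>x\<in>S. p x) = (\<Sum>x\<in>S. fps2_of_poly (p x))"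
  by (induction S rule: infinite_finite_induct) (auto simp: fps2_of_poly_add)

lemma cf_lincomb:
  assumes "finite K"
  shows "cf (lincomb K a) l = (if l \<in> K then a l else 0)"
proof -
  have "cf (mono2 k) l = (if k = l then 1 else 0)" for k
    using cf_mono2_mult[of k 1 l] by (cases k; cases l) (auto simp: cf_one zero_prod_def)
  then have "cf (const2 (a k) * mono2 k) l = (if k = l then a k else 0)" for k
    by simp
  then show ?thesis
    using assms by (simp add: lincomb_def del: cf_const2_mult)
qed

text \<open>Supplies the array form needed for reflection, in the box given by the bi-degree that
  \<open>reflection\<close> uses.\<close>

lemma fps2_of_poly_lincomb:
  "fps2_of_poly q = lincomb (box (degree_z q, degree_w q)) (\<lambda>k. coeff (coeff q (snd k)) (fst k))"
proof (rule fps2_eqI)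
  fix k
  have "coeff (coeff q (snd k)) (fst k) = 0" if "k \<notin> box (degree_z q, degree_w q)"
  proof (cases "snd k \<le> degree_w q")
    case True
    then have "degree_z q < fst k" using that by (auto simp: mem_Times_iff)
    then show ?thesis
      using degree_coeff_le_degree_z[of q "snd k"] by (intro coeff_eq_0) auto
  qed (simp add: degree_w_def coeff_eq_0)
  then show "cf (fps2_of_poly q) k =
      cf (lincomb (box (degree_z q, degree_w q)) (\<lambda>k. coeff (coeff q (snd k)) (fst k))) k"
    by (auto simp: cf_fps2_of_poly cf_lincomb)
qed

lemma fps2_of_poly_reflection:
  "fps2_of_poly (reflection q) = lincomb (box (degree_z q, degree_w q))
     (\<lambda>k. cnj (coeff (coeff q (snd ((degree_z q, degree_w q) - k))) (fst ((degree_z q, degree_w q) - k))))"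
proof (rule fps2_eqI)
  fix k :: "nat \<times> nat"
  have *: "(\<Sum>i\<le>m. if P then h i else 0) = (if P then \<Sum>i\<le>m. h i else 0)"
    for P and m and h :: "nat \<Rightarrow> complex"
    by simp
  show "cf (fps2_of_poly (reflection q)) k = cf (lincomb (box (degree_z q, degree_w q))
     (\<lambda>k. cnj (coeff (coeff q (snd ((degree_z q, degree_w q) - k))) (fst ((degree_z q, degree_w q) - k))))) k"
    by (cases k) (auto simp: cf_fps2_of_poly cf_lincomb reflection_def coeff_sum
        if_distrib[where f = "\<lambda>p. coeff p _"] * cong: if_cong)
qed

lemma l2_fps2_of_poly_mult: "l2 G \<Longrightarrow> l2 (fps2_of_poly p * G)"
  unfolding fps2_of_poly_lincomb[of p] by (rule l2_lincomb_mult)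

lemma polys_upto_smult: "p \<in> polys_upto n \<Longrightarrow> smult [:c:] p \<in> polys_upto n"
proof -
  assume "p \<in> polys_upto n"
  then obtain a where "p = (\<Sum>k\<le>n. smult [:a k:] (chi k))" by (auto simp: polys_upto_def)
  moreover have *: "smult d (sum h S) = (\<Sum>k\<in>S. smult d (h k))"
    for d and h :: "nat \<Rightarrow> complex poly poly" and S
    by (induction S rule: infinite_finite_induct) (auto simp: smult_add_right)
  ultimately have "smult [:c:] p = (\<Sum>k\<le>n. smult [:a k * c:] (chi k))"
    by (simp add: *)
  then show ?thesis by (auto simp: polys_upto_def)
qed

lemma polys_upto_diff: "p \<in> polys_upto n \<Longrightarrow> r \<in> polys_upto n \<Longrightarrow> p - r \<in> polys_upto n"
proof -
  assume "p \<in> polys_upto n" "r \<in> polys_upto n"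
  then obtain a b where "p = (\<Sum>k\<le>n. smult [:a k:] (chi k))" "r = (\<Sum>k\<le>n. smult [:b k:] (chi k))"
    by (auto simp: polys_upto_def)
  moreover have "smult [:c - d:] h = smult [:c:] h - smult [:d:] h" for c d and h :: "complex poly poly"
    by (simp flip: smult_diff_left)
  ultimately have "p - r = (\<Sum>k\<le>n. smult [:a k - b k:] (chi k))"
    by (simp add: sum_subtractf)
  then show ?thesis by (auto simp: polys_upto_def)
qed

section \<open>The minimisation problem on formal series\<close>

definition opt :: "nat \<Rightarrow> complex fps fps \<Rightarrow> complex poly poly \<Rightarrow> bool" where
  "opt n G p \<longleftrightarrow> p \<in> polys_upto n \<and>
     (\<forall>r\<in>polys_upto n. nsq (fps2_of_poly p * G - 1) \<le> nsq (fps2_of_poly r * G - 1))"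

text \<open>The minimiser comes from the orthogonal projection of 1 onto the multiples of
  \<open>G\<close>, by Pythagoras. For uniqueness, two minimisers differ by some polynomial whose
  product with \<open>G\<close> has norm 0.\<close>

lemma opt_ex1:
  assumes "l2 G" "G \<noteq> 0"
  shows "\<exists>!p. opt n G p"
proof -
  define v where "v k = fps2_of_poly (chi k) * G" for k
  have lv: "l2 (v k)" for k
    unfolding v_def using assms(1) by (rule l2_fps2_of_poly_mult)
  have l: "l2 (fps2_of_poly p * G)" "l2 (fps2_of_poly p * G - 1)" for p
    using assms(1) by (auto intro: l2_fps2_of_poly_mult l2_diff l2_one)
  have expand: "fps2_of_poly (\<Sum>k\<le>n. smult [:c k:] (chi k)) * G = (\<Sum>k<Suc n. const2 (c k) * v k)" for c
    unfolding lessThan_Suc_atMost fps2_of_poly_sum fps2_of_poly_smult sum_distrib_right v_def mult.assoc ..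
  obtain c where c: "\<forall>k<Suc n. inner2 (1 - (\<Sum>j<Suc n. const2 (c j) * v j)) (v k) = 0"
    using projection_exists[of v 1 "Suc n"] lv l2_one by blast
  define p where "p = (\<Sum>k\<le>n. smult [:c k:] (chi k))"
  have p: "p \<in> polys_upto n" by (auto simp: p_def polys_upto_def)
  have perp: "inner2 (fps2_of_poly r * G) (fps2_of_poly p * G - 1) = 0" if r': "r \<in> polys_upto n" for r
  proof -
    obtain b where r: "r = (\<Sum>k\<le>n. smult [:b k:] (chi k))" using r' by (auto simp: polys_upto_def)
    have "inner2 (v k) (1 - fps2_of_poly p * G) = 0" if "k < Suc n" for k
      using c that by (subst inner2_cnj) (simp add: p_def expand)
    then have "inner2 (v k) (fps2_of_poly p * G - 1) = 0" if "k < Suc n" for k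
      using that l lv by (simp add: inner2_diff_right l2_one)
    then show ?thesis
      unfolding r expand using lv l by (simp add: inner2_sum_left l2_const2_mult inner2_const2_left del: sum.lessThan_Suc)
  qed
  have pyth: "nsq (fps2_of_poly r * G - 1) =
      nsq (fps2_of_poly (r - p) * G) + nsq (fps2_of_poly p * G - 1)" if r': "r \<in> polys_upto n" for r
  proof -
    have eq: "fps2_of_poly r * G - 1 = fps2_of_poly (r - p) * G + (fps2_of_poly p * G - 1)"
      by (simp add: fps2_of_poly_diff algebra_simps)
    show ?thesis
      unfolding eq nsq_add[OF l(1) l(2)] using perp[OF polys_upto_diff[OF r' p]] by simp
  qed
  have "opt n G p"
    unfolding opt_def
  proof (intro conjI ballI p)
    fix r assume "r \<in> polys_upto n"
    from pyth[OF this] show "nsq (fps2_of_poly p * G - 1) \<le> nsq (fps2_of_poly r * G - 1)"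
      using nsq_nonneg[of "fps2_of_poly (r - p) * G"] by linarith
  qed
  moreover have "r = p" if r: "opt n G r" for r
  proof -
    have "nsq (fps2_of_poly r * G - 1) \<le> nsq (fps2_of_poly p * G - 1)" "r \<in> polys_upto n"
      using r p unfolding opt_def by auto
    with pyth[of r] nsq_nonneg[of "fps2_of_poly (r - p) * G"]
    have "nsq (fps2_of_poly (r - p) * G) = 0" by linarith
    then have "fps2_of_poly (r - p) * G = 0" using l nsq_eq_0 by blast
    \<comment> \<open>Formal series over a domain have no zero divisors, so \<open>G\<close>
      cancels.\<close>
    with assms(2) have "fps2_of_poly (r - p) = fps2_of_poly 0" by simp
    then show ?thesis by (simp only: fps2_of_poly_eq_iff) simp
  qed
  ultimately show ?thesis by blast
qed

text \<open>\<open>opa\<close> is a definite description, so it can be evaluated only with the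
  uniqueness in \<open>opt_ex1\<close>. The square root in \<open>H2_norm\<close> is monotone and
  does not change the minimisers.\<close>

lemma opa_eqI:
  assumes "has_bi_expansion g G" "l2 G" "G \<noteq> 0" "opt n G p"
  shows "opa n g = p"
proof -
  have "H2_norm (\<lambda>x. bipoly r x * g x - 1) = sqrt (nsq (fps2_of_poly r * G - 1))" for r
  proof -
    have "bi_taylor (\<lambda>x. bipoly r x * g x - 1) = fps2_of_poly r * G - 1"
      by (intro has_bi_expansion_unique has_bi_expansion_diff_one has_bi_expansion_bipoly_mult assms(1))
    moreover have "H2_inner h h = inner2 (bi_taylor h) (bi_taylor h)" for h
      by (simp add: H2_inner_def inner2_def cf_bi_taylor)
    ultimately show ?thesis by (simp add: H2_norm_def inner2_self)
  qed
  then have "opa n g = (THE p. opt n G p)"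
    by (simp add: opa_def opt_def)
  then show ?thesis using opt_ex1[OF assms(2,3)] assms(4) by (simp add: the1_equality)
qed

text \<open>
  If \<open>F\<close> and \<open>G\<close> give all multiples by polynomials the same norm, the two minimisation problems differ
  only in their linear terms, and \<open>c\<close> is chosen such that \<open>c * G(0) = \<bar>c\<bar>\<^sup>2 * F(0)\<close>.
\<close>

lemma opt_scale:
  assumes "l2 F" "l2 G" "\<And>p. nsq (fps2_of_poly p * G) = nsq (fps2_of_poly p * F)"
    and "cf F 0 \<noteq> 0" "cf G 0 \<noteq> 0" and c: "c = cnj (cf G 0 / cf F 0)"
    and "opt n F p"
  shows "opt n G (smult [:c:] p)"
proof -
  have c0: "c \<noteq> 0" and cG: "cf G 0 = cnj c * cf F 0" using assms by auto
  have cf0: "cf (fps2_of_poly p * A) 0 = coeff (coeff p 0) 0 * cf A 0" for p A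
    by (simp add: cf_def fps2_of_poly_def)
  \<comment> \<open>The objective for \<open>G\<close> at \<open>c r\<close> is an increasing affine
    function of the objective for \<open>F\<close> at \<open>r\<close>, so minimisers correspond
    under scaling by \<open>c\<close>.\<close>
  have J: "nsq (fps2_of_poly (smult [:c:] r) * G - 1) =
      (cmod c)\<^sup>2 * (nsq (fps2_of_poly r * F - 1) - 1) + 1" for r
  proof -
    have "complex_of_real (nsq (const2 c * A)) = of_real ((cmod c)\<^sup>2 * nsq A)" for A
      unfolding inner2_self[symmetric] of_real_mult inner2_const2_left inner2_const2_right complex_norm_square
      by simp
    then have "nsq (const2 c * A) = (cmod c)\<^sup>2 * nsq A" for A
      by (simp only: of_real_eq_iff)
    then have "nsq (fps2_of_poly (smult [:c:] r) * G) = (cmod c)\<^sup>2 * nsq (fps2_of_poly r * F)"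
      by (simp add: fps2_of_poly_smult mult.assoc assms(3))
    moreover have "cf (fps2_of_poly (smult [:c:] r) * G) 0 = (cmod c)\<^sup>2 * cf (fps2_of_poly r * F) 0"
      unfolding cf0 cG complex_norm_square by (simp add: mult_ac)
    then have "Re (cf (fps2_of_poly (smult [:c:] r) * G) 0) = (cmod c)\<^sup>2 * Re (cf (fps2_of_poly r * F) 0)"
      by simp
    ultimately show ?thesis
      using nsq_diff_one[OF l2_fps2_of_poly_mult[OF assms(1)], of r]
        nsq_diff_one[OF l2_fps2_of_poly_mult[OF assms(2)], of "smult [:c:] r"]
      by (simp add: right_diff_distrib)
  qed
  show ?thesis
    unfolding opt_def
  proof (intro conjI ballI)
    show "smult [:c:] p \<in> polys_upto n"
      using assms(7) polys_upto_smult unfolding opt_def by blast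
    fix r assume r: "r \<in> polys_upto n"
    define r' where "r' = smult [:inverse c:] r"
    have r': "r' \<in> polys_upto n" "r = smult [:c:] r'"
      using polys_upto_smult[OF r] c0 by (auto simp: r'_def one_pCons[symmetric])
    then have "nsq (fps2_of_poly p * F - 1) \<le> nsq (fps2_of_poly r' * F - 1)"
      using assms(7) unfolding opt_def by blast
    then show "nsq (fps2_of_poly (smult [:c:] p) * G - 1) \<le> nsq (fps2_of_poly r * G - 1)"
      unfolding r'(2) J by (simp add: mult_left_mono)
  qed
qed

theorem theorem3p6:
  fixes f ft :: "complex \<times> complex \<Rightarrow> complex" and q :: "complex poly poly" and n :: nat
  assumes "f \<in> H2"
    and "f (0, 0) \<noteq> 0"
    and "holomorphic_bidisk ft"
    and "\<And>z w. (z, w) \<in> bidisk \<Longrightarrow> f (z, w) = bipoly q (z, w) * ft (z, w)"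
    and "bipoly (reflection q) (0, 0) \<noteq> 0"
  shows "\<exists>c::complex. opa n f = smult [:c:] (opa n (\<lambda>x. bipoly (reflection q) x * ft x))"
proof -
  define g where "g = (\<lambda>x. bipoly (reflection q) x * ft x)"
  define A where "A = bi_taylor ft"
  define F where "F = fps2_of_poly q * A"
  define G where "G = fps2_of_poly (reflection q) * A"
  define m where "m = (degree_z q, degree_w q)"
  define a where "a = (\<lambda>k. coeff (coeff q (snd k)) (fst k))"
  have q: "fps2_of_poly q = lincomb (box m) a"
    using fps2_of_poly_lincomb[of q] by (simp add: m_def a_def)
  have rq: "fps2_of_poly (reflection q) = lincomb (box m) (\<lambda>k. cnj (a (m - k)))"
    using fps2_of_poly_reflection[of q] by (simp add: m_def a_def)
  have A: "has_bi_expansion ft A" "tame A"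
    unfolding A_def using assms(3) by (rule has_bi_expansion_bi_taylor tame_bi_taylor)+
  have F: "has_bi_expansion f F"
    unfolding F_def using has_bi_expansion_bipoly_mult[OF A(1)] by (rule has_bi_expansion_cong) (rule assms(4))
  have G: "has_bi_expansion g G"
    unfolding G_def g_def by (rule has_bi_expansion_bipoly_mult[OF A(1)])
  have lF: "l2 F"
    using assms(1) has_bi_expansion_unique[OF F] by (auto simp: H2_def l2_def cf_bi_taylor)
  \<comment> \<open>Membership of \<open>g\<close> in \<open>H2\<close> is not assumed; it is
    inherited from \<open>f\<close> through the reflection.\<close>
  have lG: "l2 G"
    using nsq_reflect_le(1)[of A m a] A lF by (simp add: F_def G_def q rq)
  \<comment> \<open>The factor p is absorbed into the tame series: reflection is applied to
    \<open>q\<close> acting on p \<open>A\<close>, and commutativity turns q p \<open>A\<close> into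
    p \<open>F\<close>.\<close>
  have nsq_eq: "nsq (fps2_of_poly p * G) = nsq (fps2_of_poly p * F)" for p
  proof -
    have "tame (fps2_of_poly p * A)"
      unfolding fps2_of_poly_lincomb[of p] using A(2) by (rule tame_lincomb_mult)
    moreover have "l2 (lincomb (box m) a * (fps2_of_poly p * A))"
      using l2_fps2_of_poly_mult[OF lF, of p] by (simp add: F_def q mult.left_commute)
    ultimately show ?thesis
      using nsq_reflect[of "fps2_of_poly p * A" m a] by (simp add: F_def G_def q rq mult.left_commute)
  qed
  have cf0: "cf H 0 = h (0, 0)" if "has_bi_expansion h H" for h H
    using has_bi_expansion_unique[OF that] cf_bi_taylor[of h 0] by (simp add: taylor_coeff_def zero_prod_def)
  have "ft (0, 0) \<noteq> 0" using assms(2) assms(4)[of 0 0] by (auto simp: bidisk_def)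
  then have nz: "cf F 0 \<noteq> 0" "cf G 0 \<noteq> 0"
    using cf0[OF F] cf0[OF G] assms(2,5) by (auto simp: g_def)
  then have "F \<noteq> 0" "G \<noteq> 0" by auto
  \<comment> \<open>The scaling lemma is used from \<open>G\<close> to \<open>F\<close>, hence this
    order in the quotient.\<close>
  define c where "c = cnj (cf F 0 / cf G 0)"
  obtain p where p: "opt n G p" using opt_ex1[OF lG \<open>G \<noteq> 0\<close>] by blast
  have "opt n F (smult [:c:] p)"
    using opt_scale[OF lG lF nsq_eq[symmetric] nz(2,1) c_def p] .
  then have "opa n f = smult [:c:] p" "opa n g = p"
    using opa_eqI[OF F lF \<open>F \<noteq> 0\<close>] opa_eqI[OF G lG \<open>G \<noteq> 0\<close> p] by auto
  then show ?thesis unfolding g_def by blast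
qed

end
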